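(* Let $(\omega_j)_{j\ge1}$ be a sequence of nonzero real numbers such that $|\omega_1|\ge|\omega_2|\ge\cdots$, let $(\alpha_j)_{j\ge1}$ be a sequence of real numbers, and let $z_1,z_2,\dots$ be independent Gaussian random variables with $z_j\sim\mathcal N(\alpha_j,1)$. Put $$Z_h=\sum_{j=1}^h\omega_jz_j^2,\qquad \overline Z_h=\frac{Z_h-E(Z_h)}{\sqrt{V(Z_h)}},\qquad \bar\alpha_h=\frac12+\frac1h\sum_{j=1}^h\alpha_j^2 .$$ If $$\lim_{h\to+\infty}\frac{\omega_1}{\omega_h}\bar\alpha_h^{-\frac16}h^{-\frac16}=0,$$ then, for every fixed $t\in\mathbb{R}$, $$\left|\ln\left(E\left(e^{\mathrm{i}t\overline Z_h}\right)\right)-\ln\left(e^{-\frac12t^2}\right)\right|=O\left(\frac{\omega_1^3}{\omega_h^3}\bar\alpha_h^{-\frac12}h^{-\frac12}\right)$$ for sufficiently large $h$ (i.e. as $h\to+\infty$).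
   Context: $E$ and $V$ denote expectation and variance, and $\mathrm{i}$ is the imaginary unit. $f(h)=O(g(h))$ means that there is a constant $C$ (which may depend on the fixed $t$) with $|f(h)|\le C|g(h)|$ for all sufficiently large $h$. $\ln$ of the characteristic function is the (complex) logarithm of the characteristic function, in the continuous branch in $t$ that vanishes at $t=0$. *)

theory Defs
  imports "HOL-Probability.Probability"
begin

text \<open>
  The continuous branch of the logarithm of a function \<open>\<phi>\<close> on the real line that vanishes at \<open>0\<close>
  (the distinguished logarithm). It exists for every continuous, zero-free \<open>\<phi>\<close> with
  \<open>\<phi> 0 = 1\<close>, and it is unique by \<open>continuous_log_unique\<close> below. In general it differs from the
  principal value \<open>Ln (\<phi> t)\<close> by a multiple of \<open>2 * pi * \<i>\<close> depending on \<open>t\<close>.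
\<close>

definition continuous_log :: "(real \<Rightarrow> complex) \<Rightarrow> real \<Rightarrow> complex" where
  "continuous_log \<phi> = (THE g. continuous_on UNIV g \<and> g 0 = 0 \<and> (\<forall>t. exp (g t) = \<phi> t))"

lemma continuous_log_unique:
  fixes f g :: "real \<Rightarrow> complex"
  assumes f: "continuous_on UNIV f" "f 0 = 0" "\<And>t. exp (f t) = \<phi> t"
    and g: "continuous_on UNIV g" "g 0 = 0" "\<And>t. exp (g t) = \<phi> t"
  shows "f = g"
proof -
  have "(\<lambda>t. f t - g t) constant_on UNIV"
  proof (rule continuous_discrete_range_constant)
    show "continuous_on UNIV (\<lambda>t. f t - g t)"
      using f(1) g(1) by (intro continuous_intros)
    show "\<exists>e>0. \<forall>y. y \<in> UNIV \<and> f y - g y \<noteq> f x - g x \<longrightarrow> e \<le> norm (f y - g y - (f x - g x))" for x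
    proof (intro exI[of _ "2 * pi"] conjI allI impI; (elim conjE)?)
      fix y assume neq: "f y - g y \<noteq> f x - g x"
      show "2 * pi \<le> norm (f y - g y - (f x - g x))"
      proof (rule ccontr)
        assume "\<not> 2 * pi \<le> norm (f y - g y - (f x - g x))"
        then have "\<bar>Im (f y - g y - (f x - g x))\<bar> < 2 * pi"
          using abs_Im_le_cmod[of "f y - g y - (f x - g x)"] by linarith
        then have "\<bar>Im (f y - g y) - Im (f x - g x)\<bar> < 2 * pi"
          by simp
        moreover have "exp (f u - g u) = 1" for u
          using f(3)[of u] g(3)[of u] exp_not_eq_zero[of "g u"] by (simp add: exp_diff)
        then have "exp (f y - g y) = exp (f x - g x)"
          by simp
        ultimately show False
          using exp_complex_eqI[of "f y - g y" "f x - g x"] neq by simp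
      qed
    qed simp
  qed simp
  then obtain c where c: "\<And>t. f t - g t = c"
    by (auto simp: constant_on_def)
  from c[of 0] have "c = 0" by (simp add: f(2) g(2))
  then have "f t = g t" for t
    using c[of t] by simp
  then show ?thesis by (rule ext)
qed

lemma continuous_log_eqI:
  assumes "continuous_on UNIV g" "g 0 = 0" "\<And>t. exp (g t) = \<phi> t"
  shows "continuous_log \<phi> = g"
  unfolding continuous_log_def
proof (rule the_equality)
  show "continuous_on UNIV g \<and> g 0 = 0 \<and> (\<forall>t. exp (g t) = \<phi> t)"
    using assms by blast
  show "f = g" if "continuous_on UNIV f \<and> f 0 = 0 \<and> (\<forall>t. exp (f t) = \<phi> t)" for f
    using that assms by (intro continuous_log_unique[where \<phi> = \<phi>]) blast+
qed

definition weighted_square_sum ::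
    "(nat \<Rightarrow> real) \<Rightarrow> (nat \<Rightarrow> 'a \<Rightarrow> real) \<Rightarrow> nat \<Rightarrow> 'a \<Rightarrow> real" where
  "weighted_square_sum \<omega> z h x = (\<Sum>j=1..h. \<omega> j * (z j x)\<^sup>2)"

definition standardized :: "'a measure \<Rightarrow> ('a \<Rightarrow> real) \<Rightarrow> 'a \<Rightarrow> real" where
  "standardized M X x =
     (X x - prob_space.expectation M X) / sqrt (prob_space.variance M X)"

definition alpha_bar :: "(nat \<Rightarrow> real) \<Rightarrow> nat \<Rightarrow> real" where
  "alpha_bar \<alpha> h = 1 / 2 + 1 / real h * (\<Sum>j=1..h. (\<alpha> j)\<^sup>2)"

end

theory Submission
  imports Defs
begin

text \<open>
  For \<open>z\<close> normal with mean \<open>a\<close> and variance \<open>1\<close>, the characteristic function of \<open>z\<^sup>2\<close> at \<open>u\<close> is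
  \<open>exp (L u)\<close> with \<open>L u = - Ln (1 - 2 * \<i> * u) / 2 + \<i> * u * a\<^sup>2 / (1 - 2 * \<i> * u)\<close>, which is
  continuous in \<open>u\<close> since \<open>1 - 2 * \<i> * u\<close> has real part \<open>1\<close>. Hence the distinguished logarithm of
  the characteristic function of the weighted sum is the sum of such terms. Because
  \<open>1 \<le> cmod (1 - 2 * \<i> * u)\<close>, the second-order Taylor remainder of \<open>L\<close> is at most
  \<open>8 * \<bar>u\<bar> ^ 3 * (1 / 2 + a\<^sup>2)\<close> for all real \<open>u\<close>. Standardization makes the linear terms cancel and
  the quadratic terms add up to \<open>- t\<^sup>2 / 2\<close>, so only the remainders survive; they are controlled by
  \<open>V \<ge> 4 * (\<omega> h)\<^sup>2 * h * alpha_bar \<alpha> h\<close> for the variance \<open>V\<close> of the sum.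
\<close>

subsection \<open>The square of a Gaussian variable\<close>

lemma normal_density_power_tendsto_top:
  "((\<lambda>x. normal_density a 1 x * x ^ k) \<longlongrightarrow> 0) at_top"
  unfolding normal_density_def by real_asymp

lemma normal_density_power_tendsto_bot:
  "((\<lambda>x. normal_density a 1 x * x ^ k) \<longlongrightarrow> 0) at_bot"
  unfolding normal_density_def by real_asymp

text \<open>Writing \<open>x\<close> as \<open>(x - a) + a\<close> and expanding binomially reduces
  the claim to the central moments.\<close>

lemma integrable_normal_power:
  "integrable lborel (\<lambda>x. normal_density a 1 x * x ^ k)"
proof -
  have "integrable lborel (\<lambda>x. \<Sum>i\<le>k. of_nat (k choose i) * a ^ (k - i) * (normal_density a 1 x * (x - a) ^ i))"
    by (intro Bochner_Integration.integrable_sum integrable_mult_right integrable_normal_moment) simp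
  also have "(\<lambda>x. \<Sum>i\<le>k. of_nat (k choose i) * a ^ (k - i) * (normal_density a 1 x * (x - a) ^ i))
      = (\<lambda>x. normal_density a 1 x * x ^ k)"
  proof
    fix x
    show "(\<Sum>i\<le>k. of_nat (k choose i) * a ^ (k - i) * (normal_density a 1 x * (x - a) ^ i))
        = normal_density a 1 x * x ^ k"
      using binomial_ring[of "x - a" a k] by (simp add: sum_distrib_left mult_ac)
  qed
  finally show ?thesis .
qed


section \<open>Moments of the Gaussian density twisted by the phase
  \<open>iexp (u * x\<^sup>2)\<close>\<close>

text \<open>The power \<open>x ^ k\<close> is carried along because differentiating in
  \<open>x\<close> or in \<open>u\<close> changes the exponent; for \<open>k = 0\<close> the
  integral is the characteristic function of the square at \<open>u\<close>.\<close>

definition gauss_sq :: "real \<Rightarrow> real \<Rightarrow> nat \<Rightarrow> real \<Rightarrow> complex" where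
  "gauss_sq a u k x = of_real (normal_density a 1 x * x ^ k) * iexp (u * x\<^sup>2)"

lemma gauss_sq_measurable [measurable]: "gauss_sq a u k \<in> borel_measurable borel"
  unfolding gauss_sq_def by measurable

lemma norm_gauss_sq: "norm (gauss_sq a u k x) = \<bar>normal_density a 1 x * x ^ k\<bar>"
  by (simp add: gauss_sq_def norm_mult norm_power abs_mult power_abs)

lemma integrable_gauss_sq: "integrable lborel (gauss_sq a u k)"
  by (rule Bochner_Integration.integrable_bound[OF integrable_normal_power[of a k]])
     (auto simp: norm_gauss_sq)

text \<open>Integrated over the line, this derivative links the moments of orders
  \<open>k - 1\<close>, \<open>k\<close> and \<open>Suc k\<close>. For \<open>k = 0\<close> the
  truncated index \<open>k - 1\<close> is harmless, since its coefficient is zero.\<close>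

lemma gauss_sq_has_vector_derivative:
  "(gauss_sq a u k has_vector_derivative
     (of_nat k * gauss_sq a u (k - 1) x - gauss_sq a u (Suc k) x
        + of_real a * gauss_sq a u k x + 2 * \<i> * of_real u * gauss_sq a u (Suc k) x)) (at x)"
proof -
  define c :: complex where "c = of_real (1 / sqrt (2 * pi))"
  \<comment> \<open>\<open>gauss_sq a u k\<close> is the restriction to the real axis of this entire
    function, so its real derivative can be read off from the complex one.\<close>
  define G where "G = (\<lambda>w. c * exp (- (w - of_real a)\<^sup>2 / 2) * w ^ k * exp (\<i> * of_real u * w\<^sup>2))"
  have eq: "gauss_sq a u m y =
      c * exp (- (of_real y - of_real a)\<^sup>2 / 2) * of_real y ^ m * exp (\<i> * of_real u * (of_real y)\<^sup>2)"
    for m y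
    unfolding gauss_sq_def normal_density_def c_def
    by (simp flip: exp_of_real add: mult_ac)
  have "(G has_field_derivative
     (of_nat k * gauss_sq a u (k - 1) x - gauss_sq a u (Suc k) x
        + of_real a * gauss_sq a u k x + 2 * \<i> * of_real u * gauss_sq a u (Suc k) x)) (at (of_real x))"
    unfolding G_def eq
    by (auto intro!: derivative_eq_intros simp: field_simps)
  from has_vector_derivative_real_field[OF this]
  show ?thesis
    by (simp add: G_def eq[abs_def])
qed

lemma gauss_sq_tendsto:
  "(gauss_sq a u k \<longlongrightarrow> 0) at_top" "(gauss_sq a u k \<longlongrightarrow> 0) at_bot"
  using normal_density_power_tendsto_top[of a k] normal_density_power_tendsto_bot[of a k]
  by (auto simp: norm_gauss_sq tendsto_norm_zero_iff[symmetric, where f = "gauss_sq a u k"]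
      intro: tendsto_rabs_zero)

definition gauss_sq_int :: "real \<Rightarrow> real \<Rightarrow> nat \<Rightarrow> complex" where
  "gauss_sq_int a u k = integral\<^sup>L lborel (gauss_sq a u k)"

text \<open>
  Stein's identity \<open>E ((z - a) * f z) = E (f' z)\<close> for \<open>f x = x ^ k * iexp (u * x\<^sup>2)\<close>.
\<close>

lemma gauss_sq_int_recurrence:
  "(1 - 2 * \<i> * of_real u) * gauss_sq_int a u (Suc k)
     = of_real a * gauss_sq_int a u k + of_nat k * gauss_sq_int a u (k - 1)"
proof -
  let ?f = "\<lambda>x. of_nat k * gauss_sq a u (k - 1) x - gauss_sq a u (Suc k) x
        + of_real a * gauss_sq a u k x + 2 * \<i> * of_real u * gauss_sq a u (Suc k) x"
  have int: "integrable lborel ?f"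
    by (intro Bochner_Integration.integrable_add Bochner_Integration.integrable_diff
        integrable_mult_right integrable_gauss_sq)
  have cont: "isCont (gauss_sq a u m) x" for m x
    using gauss_sq_has_vector_derivative has_vector_derivative_continuous by blast
  \<comment> \<open>The integrand is the derivative of \<open>gauss_sq a u k\<close>, which vanishes
    at both ends of the line.\<close>
  have "(LBINT x=-\<infinity>..\<infinity>. ?f x) = 0 - 0"
  proof (rule interval_integral_FTC_integrable[where F = "gauss_sq a u k"])
    show "(gauss_sq a u k has_vector_derivative ?f x) (at x)" for x
      by (rule gauss_sq_has_vector_derivative)
    show "isCont ?f x" for x
      by (intro continuous_intros cont)
    show "set_integrable lborel (einterval (- \<infinity>) \<infinity>) ?f"
      using int by (simp add: set_integrable_def)
  qed (use gauss_sq_tendsto in \<open>simp_all add: ereal_tendsto_simps\<close>)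
  then have "integral\<^sup>L lborel ?f = 0"
    by (simp add: interval_lebesgue_integral_def set_lebesgue_integral_def)
  then show ?thesis
    unfolding gauss_sq_int_def by (simp add: integrable_gauss_sq algebra_simps)
qed

text \<open>Differentiation under the integral sign. The first-order error is bounded explicitly by
  a multiple of \<open>(y - u)\<^sup>2\<close>, which is possible because the fourth moment is
  finite.\<close>

lemma gauss_sq_int_has_vector_derivative:
  "((\<lambda>u. gauss_sq_int a u 0) has_vector_derivative \<i> * gauss_sq_int a u 2) (at u)"
proof -
  define m where "m = (LINT x|lborel. normal_density a 1 x * x ^ 4)"
  have bound: "norm (gauss_sq_int a y 0 - gauss_sq_int a u 0 - (y - u) *\<^sub>R (\<i> * gauss_sq_int a u 2))
      \<le> m / 2 * (y - u)\<^sup>2" for y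
  proof -
    let ?g = "\<lambda>x. gauss_sq a y 0 x - gauss_sq a u 0 x - (of_real (y - u) * \<i>) * gauss_sq a u 2 x"
    have "gauss_sq_int a y 0 - gauss_sq_int a u 0 - (y - u) *\<^sub>R (\<i> * gauss_sq_int a u 2)
        = integral\<^sup>L lborel ?g"
      unfolding gauss_sq_int_def by (simp add: integrable_gauss_sq scaleR_conv_of_real)
    also have "norm \<dots> \<le> (LINT x|lborel. (y - u)\<^sup>2 / 2 * (normal_density a 1 x * x ^ 4))"
    proof (rule Bochner_Integration.integral_norm_bound_integral)
      fix x
      \<comment> \<open>Pulling out the factor \<open>iexp (u * x\<^sup>2)\<close> of modulus 1
        leaves the first-order Taylor remainder of \<open>iexp\<close> at
        \<open>(y - u) * x\<^sup>2\<close>. It is at most half the square of that argument, which is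
        where \<open>x ^ 4\<close> and hence \<open>m\<close> come from.\<close>
      have "?g x = of_real (normal_density a 1 x) * iexp (u * x\<^sup>2)
          * (iexp ((y - u) * x\<^sup>2) - (\<Sum>k\<le>1. (\<i> * of_real ((y - u) * x\<^sup>2)) ^ k / fact k))"
        by (simp add: gauss_sq_def algebra_simps flip: exp_add)
      then have "norm (?g x) = normal_density a 1 x
          * norm (iexp ((y - u) * x\<^sup>2) - (\<Sum>k\<le>1. (\<i> * of_real ((y - u) * x\<^sup>2)) ^ k / fact k))"
        by (simp only: norm_mult norm_of_real norm_exp_i_times) simp
      also have "\<dots> \<le> normal_density a 1 x * (\<bar>(y - u) * x\<^sup>2\<bar> ^ Suc 1 / fact (Suc 1))"
        by (intro mult_left_mono iexp_approx1) simp
      also have "\<dots> = (y - u)\<^sup>2 / 2 * (normal_density a 1 x * x ^ 4)"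
        by (simp add: power_mult_distrib power2_eq_square power4_eq_xxxx)
      finally show "norm (?g x) \<le> (y - u)\<^sup>2 / 2 * (normal_density a 1 x * x ^ 4)" .
    qed (intro Bochner_Integration.integrable_diff integrable_mult_right integrable_gauss_sq
        integrable_normal_power)+
    also have "\<dots> = m / 2 * (y - u)\<^sup>2"
      by (simp add: m_def)
    finally show ?thesis .
  qed
  have "((\<lambda>y. norm (gauss_sq_int a y 0 - gauss_sq_int a u 0 - (y - u) *\<^sub>R (\<i> * gauss_sq_int a u 2))
      / norm (y - u)) \<longlongrightarrow> 0) (at u)"
  proof (rule Lim_null_comparison)
    show "((\<lambda>y. m / 2 * \<bar>y - u\<bar>) \<longlongrightarrow> 0) (at u)"
      by (auto intro!: tendsto_eq_intros)
    show "\<forall>\<^sub>F y in at u. norm (norm (gauss_sq_int a y 0 - gauss_sq_int a u 0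
        - (y - u) *\<^sub>R (\<i> * gauss_sq_int a u 2)) / norm (y - u)) \<le> m / 2 * \<bar>y - u\<bar>"
      unfolding eventually_at_filter
    proof (intro always_eventually allI impI)
      fix y assume "y \<noteq> u"
      then show "norm (norm (gauss_sq_int a y 0 - gauss_sq_int a u 0
          - (y - u) *\<^sub>R (\<i> * gauss_sq_int a u 2)) / norm (y - u)) \<le> m / 2 * \<bar>y - u\<bar>"
        using bound[of y] by (simp add: divide_le_eq power2_eq_square mult.assoc)
    qed
  qed
  then show ?thesis
    unfolding has_vector_derivative_def has_derivative_iff_norm
    by (simp add: bounded_linear_scaleR_left)
qed

lemma gauss_sq_int_0: "gauss_sq_int a 0 k = of_real (LINT x|lborel. normal_density a 1 x * x ^ k)"
  unfolding gauss_sq_int_def gauss_sq_def by (simp flip: integral_complex_of_real)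

section \<open>The logarithm of the characteristic function of the square and its Taylor
  remainder\<close>

text \<open>This is the log-characteristic function of the noncentral chi-square law with one degree
  of freedom and noncentrality \<open>a\<^sup>2\<close>.\<close>

definition ln_char_sq :: "real \<Rightarrow> real \<Rightarrow> complex" where
  "ln_char_sq a u = - Ln (1 - 2 * \<i> * of_real u) / 2
     + \<i> * of_real (u * a\<^sup>2) / (1 - 2 * \<i> * of_real u)"

lemma denominator_neq_0: "1 - 2 * \<i> * of_real u \<noteq> 0"
  by (auto simp: complex_eq_iff)

lemma norm_denominator_ge_1: "norm (1 - 2 * \<i> * of_real u) \<ge> 1"
  using complex_Re_le_cmod[of "1 - 2 * \<i> * of_real u"] by simp

text \<open>The argument of \<open>Ln\<close> has real part 1 for real \<open>u\<close>, so it stays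
  off the branch cut along the nonpositive reals.\<close>

lemma Ln_denominator_has_vector_derivative:
  "((\<lambda>u. - Ln (1 - 2 * \<i> * of_real u) / 2) has_vector_derivative
     \<i> / (1 - 2 * \<i> * of_real u)) (at u)"
proof -
  have "((\<lambda>w. - Ln (1 - 2 * \<i> * w) / 2) has_field_derivative
     \<i> / (1 - 2 * \<i> * of_real u)) (at (of_real u))"
    using denominator_neq_0[of u]
    by (auto intro!: derivative_eq_intros simp: complex_nonpos_Reals_iff field_simps)
  from has_vector_derivative_real_field[OF this] show ?thesis .
qed

lemma ln_char_sq_has_vector_derivative:
  "(ln_char_sq a has_vector_derivative
     \<i> / (1 - 2 * \<i> * of_real u) + \<i> * of_real (a\<^sup>2) / (1 - 2 * \<i> * of_real u)\<^sup>2) (at u)"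
proof -
  have "((\<lambda>w. \<i> * w * of_real (a\<^sup>2) / (1 - 2 * \<i> * w)) has_field_derivative
     \<i> * of_real (a\<^sup>2) / (1 - 2 * \<i> * of_real u)\<^sup>2) (at (of_real u))"
    using denominator_neq_0[of u]
    by (auto intro!: derivative_eq_intros simp: field_simps power2_eq_square)
  from has_vector_derivative_add[OF Ln_denominator_has_vector_derivative has_vector_derivative_real_field[OF this]]
  show ?thesis
    by (simp add: ln_char_sq_def[abs_def] mult_ac)
qed

lemma ln_char_sq_0 [simp]: "ln_char_sq a 0 = 0"
  by (simp add: ln_char_sq_def)

text \<open>
  The recurrence expresses the second moment by the zeroth one, which turns the derivative
  formula into a linear first-order differential equation in \<open>u\<close>.
\<close>

lemma gauss_sq_int_eq_exp: "gauss_sq_int a u 0 = exp (ln_char_sq a u)"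
proof -
  let ?D = "\<lambda>u. 1 - 2 * \<i> * of_real u :: complex"
  let ?L' = "\<lambda>u. \<i> / ?D u + \<i> * of_real (a\<^sup>2) / (?D u)\<^sup>2"
  have J2: "\<i> * gauss_sq_int a u 2 = ?L' u * gauss_sq_int a u 0" for u
  proof -
    have "?D u * gauss_sq_int a u 1 = of_real a * gauss_sq_int a u 0"
      "?D u * gauss_sq_int a u 2 = of_real a * gauss_sq_int a u 1 + gauss_sq_int a u 0"
      using gauss_sq_int_recurrence[of u a 0] gauss_sq_int_recurrence[of u a 1]
      by (simp_all add: numeral_2_eq_2)
    then have J: "gauss_sq_int a u 1 = of_real a * gauss_sq_int a u 0 / ?D u"
      "gauss_sq_int a u 2 = (of_real a * gauss_sq_int a u 1 + gauss_sq_int a u 0) / ?D u"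
      using denominator_neq_0[of u] by (metis nonzero_mult_div_cancel_left)+
    show ?thesis
      unfolding J(2) unfolding J(1)
      by (simp add: add_divide_distrib algebra_simps power2_eq_square)
  qed
  have exp_deriv: "((\<lambda>u. exp (- ln_char_sq a u)) has_vector_derivative
      - ?L' u * exp (- ln_char_sq a u)) (at u)" for u
    using field_vector_diff_chain_at[OF
        has_vector_derivative_minus[OF ln_char_sq_has_vector_derivative[of a u]] DERIV_exp]
    by (simp only: o_def)
  \<comment> \<open>\<open>exp (- ln_char_sq a u)\<close> is an integrating factor: the product is
    constant, and its value 1 is the total mass of the density at \<open>u = 0\<close>.\<close>
  have "((\<lambda>u. gauss_sq_int a u 0 * exp (- ln_char_sq a u)) has_vector_derivative 0) (at u)" for u
    using has_vector_derivative_mult[OF gauss_sq_int_has_vector_derivative[of a u] exp_deriv[of u]]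
    unfolding J2 by (simp add: algebra_simps)
  then obtain c where c: "\<And>u. gauss_sq_int a u 0 * exp (- ln_char_sq a u) = c"
    using has_vector_derivative_zero_constant[of UNIV "\<lambda>u. gauss_sq_int a u 0 * exp (- ln_char_sq a u)"]
    by auto
  have "gauss_sq_int a 0 0 = 1"
    by (simp add: gauss_sq_int_0)
  with c[of 0] have "c = 1"
    by simp
  with c[of u] show ?thesis
    by (simp add: exp_minus field_simps)
qed

text \<open>The logarithmic and the rational part are expanded separately, with remainders
  \<open>R\<close> and \<open>Q\<close>. The factor \<open>1 / 2 + a\<^sup>2\<close> is chosen
  because its sum over the indices is \<open>h * alpha_bar \<alpha> h\<close>.\<close>

lemma ln_char_sq_remainder:
  "norm (ln_char_sq a u - (\<i> * of_real (u * (1 + a\<^sup>2)) - of_real (u\<^sup>2 * (1 + 2 * a\<^sup>2))))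
     \<le> 8 * \<bar>u\<bar> ^ 3 * (1 / 2 + a\<^sup>2)"
proof -
  let ?D = "\<lambda>u. 1 - 2 * \<i> * of_real u :: complex"
  define R where "R v = - Ln (?D v) / 2 - \<i> * of_real v + of_real (v\<^sup>2)" for v
  have R': "(R has_vector_derivative - 4 * \<i> * of_real (v\<^sup>2) / ?D v) (at v)" for v
  proof -
    have "((\<lambda>w. - \<i> * w + w\<^sup>2) has_field_derivative (- \<i> + 2 * of_real v)) (at (of_real v))"
      by (auto intro!: derivative_eq_intros)
    from has_vector_derivative_add[OF Ln_denominator_has_vector_derivative has_vector_derivative_real_field[OF this]]
    have "(R has_vector_derivative \<i> / ?D v + (- \<i> + 2 * of_real v)) (at v)"
      by (simp add: R_def[abs_def] algebra_simps)
    also have "\<i> / ?D v + (- \<i> + 2 * of_real v) = - 4 * \<i> * of_real (v\<^sup>2) / ?D v"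
      using denominator_neq_0[of v] by (simp add: field_simps power2_eq_square)
    finally show ?thesis .
  qed
  \<comment> \<open>Mean value inequality on the segment from 0 to \<open>u\<close>: the derivative
    of \<open>R\<close> vanishes at 0 and is at most \<open>4 * u\<^sup>2\<close> in modulus on the
    segment.\<close>
  have "norm (R u - R 0 - (u - 0) *\<^sub>R (- 4 * \<i> * of_real (0\<^sup>2) / ?D 0)) \<le> norm (u - 0) * (4 * u\<^sup>2)"
  proof (rule vector_differentiable_bound_linearization[where S = "closed_segment 0 u"])
    fix v assume "v \<in> closed_segment 0 u"
    then have "v\<^sup>2 \<le> u\<^sup>2"
      by (auto simp: closed_segment_eq_real_ivl abs_le_square_iff[symmetric] split: if_splits)
    have "norm (- 4 * \<i> * of_real (v\<^sup>2) / ?D v) = 4 * v\<^sup>2 / norm (?D v)"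
      by (simp add: norm_divide norm_mult norm_power)
    also have "\<dots> \<le> 4 * v\<^sup>2 / 1"
      by (intro divide_left_mono norm_denominator_ge_1) (use norm_denominator_ge_1[of v] in auto)
    finally show "norm (- 4 * \<i> * of_real (v\<^sup>2) / ?D v - - 4 * \<i> * of_real (0\<^sup>2) / ?D 0) \<le> 4 * u\<^sup>2"
      using \<open>v\<^sup>2 \<le> u\<^sup>2\<close> by simp
    show "(R has_vector_derivative - 4 * \<i> * of_real (v\<^sup>2) / ?D v) (at v within closed_segment 0 u)"
      using R' by (rule has_vector_derivative_at_within)
  qed auto
  then have R_bound: "norm (R u) \<le> 4 * \<bar>u\<bar> ^ 3"
    by (simp add: R_def power2_eq_square power3_eq_cube abs_mult)
  \<comment> \<open>The exact remainder from
    \<open>1 / (1 - w) = 1 + w + w\<^sup>2 / (1 - w)\<close> with \<open>w = 2 * \<i> * u\<close>,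
    multiplied by \<open>\<i> * u * a\<^sup>2\<close>.\<close>
  define Q where "Q = - 4 * \<i> * of_real (a\<^sup>2 * u ^ 3) / ?D u"
  have "norm Q = 4 * a\<^sup>2 * \<bar>u\<bar> ^ 3 / norm (?D u)"
    by (simp add: Q_def norm_divide norm_mult norm_power)
  also have "\<dots> \<le> 4 * a\<^sup>2 * \<bar>u\<bar> ^ 3 / 1"
    by (intro divide_left_mono norm_denominator_ge_1) (use norm_denominator_ge_1[of u] in auto)
  finally have Q_bound: "norm Q \<le> 4 * a\<^sup>2 * \<bar>u\<bar> ^ 3"
    by simp
  have "ln_char_sq a u - (\<i> * of_real (u * (1 + a\<^sup>2)) - of_real (u\<^sup>2 * (1 + 2 * a\<^sup>2))) = R u + Q"
  proof -
    have "\<i> * of_real (u * a\<^sup>2) / ?D u = \<i> * of_real (u * a\<^sup>2) - of_real (2 * u\<^sup>2 * a\<^sup>2) + Q"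
      unfolding Q_def using denominator_neq_0[of u]
      by (simp add: field_simps power2_eq_square power3_eq_cube)
    then show ?thesis
      by (simp add: ln_char_sq_def R_def algebra_simps)
  qed
  then have "norm (ln_char_sq a u - (\<i> * of_real (u * (1 + a\<^sup>2)) - of_real (u\<^sup>2 * (1 + 2 * a\<^sup>2))))
      \<le> norm (R u) + norm Q"
    by (simp add: norm_triangle_ineq)
  also have "\<dots> \<le> 4 * \<bar>u\<bar> ^ 3 + 4 * a\<^sup>2 * \<bar>u\<bar> ^ 3"
    using R_bound Q_bound by linarith
  also have "\<dots> \<le> 8 * \<bar>u\<bar> ^ 3 * (1 / 2 + a\<^sup>2)"
    by (simp add: algebra_simps mult_nonneg_nonneg)
  finally show ?thesis .
qed

section \<open>Raw moments of the normal density\<close>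

text \<open>At \<open>u = 0\<close> the phase is 1, so the twisted recurrence becomes one between
  real moments.\<close>

lemma integral_normal_power_recurrence:
  "(LINT x|lborel. normal_density a 1 x * x ^ Suc k)
     = a * (LINT x|lborel. normal_density a 1 x * x ^ k)
       + of_nat k * (LINT x|lborel. normal_density a 1 x * x ^ (k - 1))"
proof -
  have "complex_of_real (LINT x|lborel. normal_density a 1 x * x ^ Suc k)
     = of_real (a * (LINT x|lborel. normal_density a 1 x * x ^ k)
       + of_nat k * (LINT x|lborel. normal_density a 1 x * x ^ (k - 1)))"
    using gauss_sq_int_recurrence[of 0 a k] by (simp add: gauss_sq_int_0 del: power_Suc)
  then show ?thesis
    by (simp only: of_real_eq_iff)
qed

lemma integral_normal_power:
  "(LINT x|lborel. normal_density a 1 x * x ^ 2) = a\<^sup>2 + 1"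
  "(LINT x|lborel. normal_density a 1 x * x ^ 4) = a ^ 4 + 6 * a\<^sup>2 + 3"
proof -
  have m0: "(LINT x|lborel. normal_density a 1 x * x ^ 0) = 1"
    by simp
  have m1: "(LINT x|lborel. normal_density a 1 x * x ^ 1) = a"
    using integral_normal_power_recurrence[of a 0] m0 by (simp del: power_0)
  show m2: "(LINT x|lborel. normal_density a 1 x * x ^ 2) = a\<^sup>2 + 1"
    using integral_normal_power_recurrence[of a 1] m0 m1 unfolding Suc_1
    by (simp add: power2_eq_square)
  have m3: "(LINT x|lborel. normal_density a 1 x * x ^ 3) = a ^ 3 + 3 * a"
    using integral_normal_power_recurrence[of a 2] m1 m2
    by (simp add: power2_eq_square power3_eq_cube algebra_simps)
  show "(LINT x|lborel. normal_density a 1 x * x ^ 4) = a ^ 4 + 6 * a\<^sup>2 + 3"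
    using integral_normal_power_recurrence[of a 3] m2 m3
    by (simp add: power2_eq_square power3_eq_cube power4_eq_xxxx algebra_simps)
qed

subsection \<open>Weighted sums of independent squares\<close>

context prob_space
begin

text \<open>Bienayme's identity: after centring, independence makes the expectation of every mixed
  product vanish, and only the diagonal of the squared sum survives.\<close>

lemma variance_sum_indep_vars:
  fixes X :: "'i \<Rightarrow> 'a \<Rightarrow> real"
  assumes I: "finite I" and indep: "indep_vars (\<lambda>_. borel) X I"
    and sq: "\<And>i. i \<in> I \<Longrightarrow> integrable M (\<lambda>x. (X i x)\<^sup>2)"
  shows "variance (\<lambda>x. \<Sum>i\<in>I. X i x) = (\<Sum>i\<in>I. variance (X i))"
proof -
  have rv: "random_variable borel (X i)" if "i \<in> I" for i
    using indep that by (auto simp: indep_vars_def)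
  have int: "integrable M (X i)" if "i \<in> I" for i
    using square_integrable_imp_integrable[OF rv sq] that by blast
  define Y where "Y i x = X i x - expectation (X i)" for i x
  have Y_indep: "indep_vars (\<lambda>_. borel) Y I"
    unfolding Y_def by (rule indep_vars_compose2[OF indep]) simp
  have Y_int: "integrable M (Y i)" and Y_0: "expectation (Y i) = 0" if "i \<in> I" for i
    using int[OF that] by (auto simp: Y_def[abs_def] prob_space)
  have Y_sq: "integrable M (\<lambda>x. Y i x * Y i x)" if "i \<in> I" for i
    using int[OF that] sq[OF that] by (auto simp: Y_def power2_eq_square algebra_simps)
  have cov: "integrable M (\<lambda>x. Y i x * Y j x) \<and>
      expectation (\<lambda>x. Y i x * Y j x) = (if i = j then variance (X i) else 0)"
    if ij: "i \<in> I" "j \<in> I" for i j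
  proof (cases "i = j")
    case True
    then show ?thesis
      using Y_sq[OF ij(1)] by (simp add: Y_def power2_eq_square)
  next
    case False
    have "indep_vars (\<lambda>_. borel) Y {i, j}"
      using ij by (intro indep_vars_subset[OF Y_indep]) auto
    then show ?thesis
      using indep_vars_lebesgue_integral[of "{i, j}" Y] indep_vars_integrable[of "{i, j}" Y]
        Y_int Y_0 ij False by auto
  qed
  have "(\<Sum>i\<in>I. X i x) - expectation (\<lambda>x. \<Sum>i\<in>I. X i x) = (\<Sum>i\<in>I. Y i x)" for x
    by (simp add: int Y_def sum_subtractf)
  then have "variance (\<lambda>x. \<Sum>i\<in>I. X i x) = expectation (\<lambda>x. \<Sum>i\<in>I. \<Sum>j\<in>I. Y i x * Y j x)"
    by (simp add: power2_eq_square sum_product)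
  also have "\<dots> = (\<Sum>i\<in>I. \<Sum>j\<in>I. expectation (\<lambda>x. Y i x * Y j x))"
    by (subst Bochner_Integration.integral_sum, use cov in auto)+
  also have "\<dots> = (\<Sum>i\<in>I. variance (X i))"
    using cov I by (intro sum.cong) (auto simp: sum.delta)
  finally show ?thesis .
qed

text \<open>Expectations of functions of \<open>X\<close> are integrals against the normal density:
  the second and fourth moments give mean and variance, and the characteristic function is
  \<open>gauss_sq_int a u 0\<close>.\<close>

lemma distributed_normal_sq:
  assumes X: "distributed M lborel X (normal_density a 1)"
  shows "integrable M (\<lambda>x. (X x)\<^sup>2)" "integrable M (\<lambda>x. ((X x)\<^sup>2)\<^sup>2)"
    "expectation (\<lambda>x. (X x)\<^sup>2) = 1 + a\<^sup>2"
    "variance (\<lambda>x. (X x)\<^sup>2) = 2 + 4 * a\<^sup>2"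
    "expectation (\<lambda>x. iexp (u * (X x)\<^sup>2)) = exp (ln_char_sq a u)"
proof -
  have nn: "0 \<le> normal_density a 1 x" for x
    by simp
  have pow: "integrable M (\<lambda>x. X x ^ k)"
    "expectation (\<lambda>x. X x ^ k) = (LINT x|lborel. normal_density a 1 x * x ^ k)" for k
    using distributed_integrable[OF X, of "\<lambda>x. x ^ k"] distributed_integral[OF X, of "\<lambda>x. x ^ k"]
      integrable_normal_power[of a k] nn by auto
  show 1: "integrable M (\<lambda>x. (X x)\<^sup>2)"
    by (rule pow)
  have 4: "((X x)\<^sup>2)\<^sup>2 = X x ^ 4" for x
    by simp
  show 2: "integrable M (\<lambda>x. ((X x)\<^sup>2)\<^sup>2)"
    unfolding 4 by (rule pow)
  show E: "expectation (\<lambda>x. (X x)\<^sup>2) = 1 + a\<^sup>2"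
    by (simp add: pow integral_normal_power)
  show "variance (\<lambda>x. (X x)\<^sup>2) = 2 + 4 * a\<^sup>2"
    unfolding variance_eq[OF 1 2] unfolding E unfolding 4 pow integral_normal_power
    by (simp add: power2_eq_square power4_eq_xxxx algebra_simps)
  have [measurable]: "random_variable borel X"
    using distributed_measurable[OF X] by simp
  have "expectation (\<lambda>x. iexp (u * (X x)\<^sup>2)) = integral\<^sup>L (distr M lborel X) (\<lambda>x. iexp (u * x\<^sup>2))"
    by (simp add: integral_distr)
  also have "\<dots> = gauss_sq_int a u 0"
    unfolding distributed_distr_eq_density[OF X] gauss_sq_int_def gauss_sq_def
    by (simp add: integral_density scaleR_conv_of_real)
  finally show "expectation (\<lambda>x. iexp (u * (X x)\<^sup>2)) = exp (ln_char_sq a u)"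
    by (simp add: gauss_sq_int_eq_exp)
qed

text \<open>Everything reduces to single summands: by linearity for the mean, by Bienayme's identity
  for the variance, and by factorization of the expectation of a product of independent bounded
  variables for the characteristic function.\<close>

lemma
  assumes indep: "indep_vars (\<lambda>_. borel) z {1..}"
    and normal: "\<And>j. j \<ge> 1 \<Longrightarrow> distributed M lborel (z j) (normal_density (\<alpha> j) 1)"
  shows expectation_weighted_square_sum:
      "expectation (weighted_square_sum \<omega> z h) = (\<Sum>j=1..h. \<omega> j * (1 + (\<alpha> j)\<^sup>2))"
    and variance_weighted_square_sum:
      "variance (weighted_square_sum \<omega> z h) = (\<Sum>j=1..h. (\<omega> j)\<^sup>2 * (2 + 4 * (\<alpha> j)\<^sup>2))"
    and char_weighted_square_sum:
      "expectation (\<lambda>x. iexp (s * weighted_square_sum \<omega> z h x))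
         = exp (\<Sum>j=1..h. ln_char_sq (\<alpha> j) (s * \<omega> j))"
proof -
  note sq = distributed_normal_sq[OF normal]
  have indep_h: "indep_vars (\<lambda>_. borel) z {1..h}"
    by (rule indep_vars_subset[OF indep]) auto
  show "expectation (weighted_square_sum \<omega> z h) = (\<Sum>j=1..h. \<omega> j * (1 + (\<alpha> j)\<^sup>2))"
    unfolding weighted_square_sum_def
    by (subst Bochner_Integration.integral_sum) (auto simp: sq)
  have "variance (weighted_square_sum \<omega> z h) = (\<Sum>j=1..h. variance (\<lambda>x. \<omega> j * (z j x)\<^sup>2))"
    unfolding weighted_square_sum_def
  proof (rule variance_sum_indep_vars)
    show "indep_vars (\<lambda>_. borel) (\<lambda>j x. \<omega> j * (z j x)\<^sup>2) {1..h}"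
      by (rule indep_vars_compose2[OF indep_h]) simp
    show "integrable M (\<lambda>x. (\<omega> j * (z j x)\<^sup>2)\<^sup>2)" if "j \<in> {1..h}" for j
      using sq(2)[of j] that by (simp add: power_mult_distrib)
  qed simp
  also have "\<dots> = (\<Sum>j=1..h. (\<omega> j)\<^sup>2 * (2 + 4 * (\<alpha> j)\<^sup>2))"
  proof (rule sum.cong)
    fix j assume "j \<in> {1..h}"
    then show "variance (\<lambda>x. \<omega> j * (z j x)\<^sup>2) = (\<omega> j)\<^sup>2 * (2 + 4 * (\<alpha> j)\<^sup>2)"
      using sq(4)[of j] by (simp flip: right_diff_distrib add: power_mult_distrib)
  qed simp
  finally show "variance (weighted_square_sum \<omega> z h) = (\<Sum>j=1..h. (\<omega> j)\<^sup>2 * (2 + 4 * (\<alpha> j)\<^sup>2))" .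
  have "iexp (s * weighted_square_sum \<omega> z h x) = (\<Prod>j=1..h. iexp (s * \<omega> j * (z j x)\<^sup>2))" for x
    by (simp add: weighted_square_sum_def sum_distrib_left exp_sum mult_ac)
  then have "expectation (\<lambda>x. iexp (s * weighted_square_sum \<omega> z h x))
      = expectation (\<lambda>x. \<Prod>j=1..h. iexp (s * \<omega> j * (z j x)\<^sup>2))"
    by simp
  also have "\<dots> = (\<Prod>j=1..h. expectation (\<lambda>x. iexp (s * \<omega> j * (z j x)\<^sup>2)))"
  proof (rule indep_vars_lebesgue_integral)
    show "indep_vars (\<lambda>_. borel) (\<lambda>j x. iexp (s * \<omega> j * (z j x)\<^sup>2)) {1..h}"
      by (rule indep_vars_compose2[OF indep_h]) simp
    show "integrable M (\<lambda>x. iexp (s * \<omega> j * (z j x)\<^sup>2))" if "j \<in> {1..h}" for j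
    proof -
      have [measurable]: "random_variable borel (z j)"
        using distributed_measurable[OF normal[of j]] that by simp
      show ?thesis
        by (rule integrable_const_bound[where B = 1]) auto
    qed
  qed simp
  also have "\<dots> = exp (\<Sum>j=1..h. ln_char_sq (\<alpha> j) (s * \<omega> j))"
    unfolding exp_sum[OF finite_atLeastAtMost] by (intro prod.cong refl sq(5)) simp
  finally show "expectation (\<lambda>x. iexp (s * weighted_square_sum \<omega> z h x))
      = exp (\<Sum>j=1..h. ln_char_sq (\<alpha> j) (s * \<omega> j))" .
qed

end

section \<open>The remainder estimate for the weighted sum\<close>

lemma alpha_bar_pos: "alpha_bar \<alpha> h > 0"
  unfolding alpha_bar_def by (intro add_pos_nonneg mult_nonneg_nonneg sum_nonneg) auto

lemma alpha_bar_mult: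
  assumes "h \<ge> 1"
  shows "real h * alpha_bar \<alpha> h = (\<Sum>j=1..h. 1 / 2 + (\<alpha> j)\<^sup>2)"
proof -
  have "(\<Sum>j=1..h. 1 / 2 + (\<alpha> j)\<^sup>2) = real h / 2 + (\<Sum>j=1..h. (\<alpha> j)\<^sup>2)"
    by (simp add: sum.distrib)
  then show ?thesis
    using assms by (simp add: alpha_bar_def distrib_left)
qed

lemma abs_weight_antimono:
  fixes \<omega> :: "nat \<Rightarrow> real"
  assumes "\<And>j. j \<ge> 1 \<Longrightarrow> \<bar>\<omega> (Suc j)\<bar> \<le> \<bar>\<omega> j\<bar>" "1 \<le> i" "i \<le> j"
  shows "\<bar>\<omega> j\<bar> \<le> \<bar>\<omega> i\<bar>"
  using assms(3)
proof (induction j rule: dec_induct)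
  case (step n)
  then show ?case
    using assms(1)[of n] assms(2) by linarith
qed simp

text \<open>The analytic core, free of probability: \<open>E\<close> and \<open>V\<close> are the
  mean and variance of the weighted sum. Subtracting the centring phase and the Gaussian logarithm
  leaves only the Taylor remainders of the summands.\<close>

lemma ln_char_remainder_sum:
  fixes \<omega> \<alpha> :: "nat \<Rightarrow> real"
  assumes h: "h \<ge> 1" and nz: "\<omega> h \<noteq> 0"
    and mono: "\<And>j. j \<ge> 1 \<Longrightarrow> \<bar>\<omega> (Suc j)\<bar> \<le> \<bar>\<omega> j\<bar>"
    and V: "V = (\<Sum>j=1..h. (\<omega> j)\<^sup>2 * (2 + 4 * (\<alpha> j)\<^sup>2))"
    and E: "E = (\<Sum>j=1..h. \<omega> j * (1 + (\<alpha> j)\<^sup>2))"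
  shows "V > 0"
    and "norm ((\<Sum>j=1..h. ln_char_sq (\<alpha> j) (t / sqrt V * \<omega> j)) - \<i> * of_real (t / sqrt V * E) + of_real (t\<^sup>2 / 2))
      \<le> \<bar>t\<bar> ^ 3 * norm ((\<omega> 1) ^ 3 / (\<omega> h) ^ 3 * alpha_bar \<alpha> h powr (- (1 / 2)) * real h powr (- (1 / 2)))"
proof -
  define B where "B = real h * alpha_bar \<alpha> h"
  have B: "B > 0"
    using h alpha_bar_pos by (simp add: B_def)
  have B_sum: "B = (\<Sum>j=1..h. 1 / 2 + (\<alpha> j)\<^sup>2)"
    unfolding B_def by (rule alpha_bar_mult[OF h])
  \<comment> \<open>Up to index \<open>h\<close> no weight is smaller in modulus than
    \<open>\<omega> h\<close>, and \<open>2 + 4 * a\<^sup>2\<close> equals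
    \<open>4 * (1 / 2 + a\<^sup>2)\<close>.\<close>
  have V_ge: "4 * (\<omega> h)\<^sup>2 * B \<le> V"
    unfolding V B_sum sum_distrib_left
  proof (rule sum_mono)
    fix j assume "j \<in> {1..h}"
    then have "\<bar>\<omega> h\<bar> \<le> \<bar>\<omega> j\<bar>"
      by (intro abs_weight_antimono[of \<omega>, OF mono]) auto
    then have "(\<omega> h)\<^sup>2 \<le> (\<omega> j)\<^sup>2"
      by (simp add: abs_le_square_iff)
    then have "(\<omega> h)\<^sup>2 * (2 + 4 * (\<alpha> j)\<^sup>2) \<le> (\<omega> j)\<^sup>2 * (2 + 4 * (\<alpha> j)\<^sup>2)"
      by (intro mult_right_mono) auto
    then show "4 * (\<omega> h)\<^sup>2 * (1 / 2 + (\<alpha> j)\<^sup>2) \<le> (\<omega> j)\<^sup>2 * (2 + 4 * (\<alpha> j)\<^sup>2)"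
      by (simp add: algebra_simps)
  qed
  have pos: "4 * (\<omega> h)\<^sup>2 * B > 0"
    using nz B by simp
  with V_ge show V_pos: "V > 0"
    by linarith
  define s where "s = t / sqrt V"
  have s2: "s\<^sup>2 * V = t\<^sup>2"
    using V_pos by (simp add: s_def power_divide)
  \<comment> \<open>The linear Taylor terms add up to \<open>s * E\<close>. The quadratic ones add
    up to \<open>s\<^sup>2 * V / 2 = t\<^sup>2 / 2\<close>, because the variance
    \<open>2 + 4 * a\<^sup>2\<close> of a square is twice \<open>1 + 2 * a\<^sup>2\<close>.\<close>
  have lin: "s * E = (\<Sum>j=1..h. (s * \<omega> j) * (1 + (\<alpha> j)\<^sup>2))"
    unfolding E by (simp add: sum_distrib_left mult.assoc)
  have quad: "t\<^sup>2 / 2 = (\<Sum>j=1..h. (s * \<omega> j)\<^sup>2 * (1 + 2 * (\<alpha> j)\<^sup>2))"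
    unfolding s2[symmetric] V sum_distrib_left sum_divide_distrib
    by (intro sum.cong) (simp_all add: power_mult_distrib field_simps)
  have "norm ((\<Sum>j=1..h. ln_char_sq (\<alpha> j) (s * \<omega> j)) - \<i> * of_real (s * E) + of_real (t\<^sup>2 / 2))
      = norm (\<Sum>j=1..h. ln_char_sq (\<alpha> j) (s * \<omega> j)
          - (\<i> * of_real ((s * \<omega> j) * (1 + (\<alpha> j)\<^sup>2)) - of_real ((s * \<omega> j)\<^sup>2 * (1 + 2 * (\<alpha> j)\<^sup>2))))"
    unfolding lin quad of_real_sum
    by (simp only: sum_subtractf sum_distrib_left) (simp add: algebra_simps)
  also have "\<dots> \<le> (\<Sum>j=1..h. 8 * \<bar>s * \<omega> j\<bar> ^ 3 * (1 / 2 + (\<alpha> j)\<^sup>2))"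
    by (intro sum_norm_le ln_char_sq_remainder)
  also have "\<dots> \<le> (\<Sum>j=1..h. 8 * \<bar>s * \<omega> 1\<bar> ^ 3 * (1 / 2 + (\<alpha> j)\<^sup>2))"
  proof (intro sum_mono mult_right_mono mult_left_mono power_mono)
    fix j assume "j \<in> {1..h}"
    then have "\<bar>\<omega> j\<bar> \<le> \<bar>\<omega> 1\<bar>"
      by (intro abs_weight_antimono[of \<omega>, OF mono]) auto
    then show "\<bar>s * \<omega> j\<bar> \<le> \<bar>s * \<omega> 1\<bar>"
      by (simp add: abs_mult mult_left_mono)
  qed auto
  also have "\<dots> = 8 * \<bar>s * \<omega> 1\<bar> ^ 3 * B"
    by (simp only: B_sum sum_distrib_left)
  \<comment> \<open>The lower bound on \<open>V\<close> gives
    \<open>sqrt V \<ge> 2 * \<bar>\<omega> h\<bar> * sqrt B\<close>; the cube of the 2 then cancels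
    the factor 8, leaving the constant \<open>\<bar>t\<bar> ^ 3\<close>.\<close>
  also have "\<dots> \<le> 8 * (\<bar>t\<bar> * \<bar>\<omega> 1\<bar> / (2 * \<bar>\<omega> h\<bar> * sqrt B)) ^ 3 * B"
  proof (intro mult_right_mono mult_left_mono power_mono)
    have "2 * \<bar>\<omega> h\<bar> * sqrt B = sqrt (4 * (\<omega> h)\<^sup>2 * B)"
      by (simp add: real_sqrt_mult)
    also have "\<dots> \<le> sqrt V"
      using V_ge by (rule real_sqrt_le_mono)
    finally have "\<bar>t\<bar> * \<bar>\<omega> 1\<bar> / sqrt V \<le> \<bar>t\<bar> * \<bar>\<omega> 1\<bar> / (2 * \<bar>\<omega> h\<bar> * sqrt B)"
      using nz B V_pos by (intro divide_left_mono) auto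
    then show "\<bar>s * \<omega> 1\<bar> \<le> \<bar>t\<bar> * \<bar>\<omega> 1\<bar> / (2 * \<bar>\<omega> h\<bar> * sqrt B)"
      using V_pos by (simp add: s_def abs_mult)
  qed (use B in auto)
  also have "\<dots> = \<bar>t\<bar> ^ 3 * (\<bar>\<omega> 1\<bar> ^ 3 / \<bar>\<omega> h\<bar> ^ 3 * (B / sqrt B ^ 3))"
    by (simp add: power_divide power_mult_distrib)
  also have "B / sqrt B ^ 3 = 1 / sqrt B"
    using B by (simp add: power3_eq_cube field_simps)
  also have "1 / sqrt B = alpha_bar \<alpha> h powr (- (1 / 2)) * real h powr (- (1 / 2))"
    using alpha_bar_pos[of \<alpha> h] by (simp add: B_def powr_minus powr_half_sqrt real_sqrt_mult field_simps)
  finally show "norm ((\<Sum>j=1..h. ln_char_sq (\<alpha> j) (t / sqrt V * \<omega> j)) - \<i> * of_real (t / sqrt V * E) + of_real (t\<^sup>2 / 2))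
      \<le> \<bar>t\<bar> ^ 3 * norm ((\<omega> 1) ^ 3 / (\<omega> h) ^ 3 * alpha_bar \<alpha> h powr (- (1 / 2)) * real h powr (- (1 / 2)))"
    by (simp add: s_def abs_mult power_abs mult_ac)
qed

section \<open>Identification of the distinguished logarithms and the final bound\<close>

theorem theorem2:
  fixes M :: "'a measure"
    and z :: "nat \<Rightarrow> 'a \<Rightarrow> real"
    and \<omega> \<alpha> :: "nat \<Rightarrow> real"
  assumes "prob_space M"
    and "\<And>j. j \<ge> 1 \<Longrightarrow> \<omega> j \<noteq> 0"
    and "\<And>j. j \<ge> 1 \<Longrightarrow> \<bar>\<omega> (Suc j)\<bar> \<le> \<bar>\<omega> j\<bar>"
    and "prob_space.indep_vars M (\<lambda>_. borel) z {1..}"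
    and "\<And>j. j \<ge> 1 \<Longrightarrow> distributed M lborel (z j) (normal_density (\<alpha> j) 1)"
    and "(\<lambda>h. \<omega> 1 / \<omega> h * alpha_bar \<alpha> h powr (- (1 / 6)) * real h powr (- (1 / 6)))
           \<longlonglongrightarrow> 0"
  shows "\<forall>t::real.
    (\<lambda>h. cmod
        (continuous_log
           (\<lambda>s. prob_space.expectation M
                  (\<lambda>x. exp (\<i> * of_real (s * standardized M (weighted_square_sum \<omega> z h) x)))) t
         - continuous_log (\<lambda>s. of_real (exp (- (1 / 2) * s\<^sup>2))) t))
    \<in> O(\<lambda>h. (\<omega> 1) ^ 3 / (\<omega> h) ^ 3 * alpha_bar \<alpha> h powr (- (1 / 2)) * real h powr (- (1 / 2)))"
proof
  fix t :: real
  interpret prob_space M by fact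
  have gauss: "continuous_log (\<lambda>s. of_real (exp (- (1 / 2) * s\<^sup>2))) = (\<lambda>s. of_real (- (1 / 2) * s\<^sup>2))"
  proof (rule continuous_log_eqI)
    show "exp (complex_of_real (- (1 / 2) * s\<^sup>2)) = of_real (exp (- (1 / 2) * s\<^sup>2))" for s :: real
      by (rule exp_of_real)
  qed (auto intro!: continuous_intros)
  show "(\<lambda>h. cmod
        (continuous_log
           (\<lambda>s. expectation (\<lambda>x. exp (\<i> * of_real (s * standardized M (weighted_square_sum \<omega> z h) x)))) t
         - continuous_log (\<lambda>s. of_real (exp (- (1 / 2) * s\<^sup>2))) t))
    \<in> O(\<lambda>h. (\<omega> 1) ^ 3 / (\<omega> h) ^ 3 * alpha_bar \<alpha> h powr (- (1 / 2)) * real h powr (- (1 / 2)))"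
  \<comment> \<open>The constant depends only on \<open>t\<close>, and the estimate holds from
    \<open>h = 1\<close> on; at \<open>h = 0\<close> the sum is empty and \<open>\<omega> 0\<close>
    is unconstrained.\<close>
  proof (rule bigoI[of _ "\<bar>t\<bar> ^ 3"], rule eventually_sequentiallyI[of 1])
    fix h :: nat assume h: "1 \<le> h"
    let ?Z = "weighted_square_sum \<omega> z h"
    note remainder = ln_char_remainder_sum[OF h assms(2)[OF h] assms(3)
        variance_weighted_square_sum[OF assms(4,5)] expectation_weighted_square_sum[OF assms(4,5)]]
    have V: "variance ?Z > 0"
      by (rule remainder(1))
    let ?c = "\<lambda>s. s / sqrt (variance ?Z)"
    \<comment> \<open>The candidate branch: the summands' logarithms at the rescaled argument, minus
      the phase produced by centring. It is continuous, vanishes at 0 and exponentiates to the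
      characteristic function, so uniqueness identifies it with
      \<open>continuous_log\<close>.\<close>
    let ?g = "\<lambda>s. (\<Sum>j=1..h. ln_char_sq (\<alpha> j) (?c s * \<omega> j)) - \<i> * of_real (?c s * expectation ?Z)"
    have "continuous_log (\<lambda>s. expectation (\<lambda>x. exp (\<i> * of_real (s * standardized M ?Z x)))) = ?g"
    proof (rule continuous_log_eqI)
      have "continuous_on UNIV (ln_char_sq a)" for a
        using ln_char_sq_has_vector_derivative has_vector_derivative_continuous
        by (blast intro: continuous_at_imp_continuous_on)
      then have "continuous_on UNIV (\<lambda>s. ln_char_sq a (?c s * b))" for a b
        by (rule continuous_on_compose2) (use V in \<open>auto intro!: continuous_intros\<close>)
      then show "continuous_on UNIV ?g"
        by (intro continuous_intros) (use V in auto)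
      show "exp (?g s) = expectation (\<lambda>x. exp (\<i> * of_real (s * standardized M ?Z x)))" for s
      proof -
        have "exp (\<i> * of_real (s * standardized M ?Z x))
            = exp (- \<i> * of_real (?c s * expectation ?Z)) * iexp (?c s * ?Z x)" for x
          by (simp add: standardized_def diff_divide_distrib algebra_simps flip: exp_add)
        then have "expectation (\<lambda>x. exp (\<i> * of_real (s * standardized M ?Z x)))
            = exp (- \<i> * of_real (?c s * expectation ?Z)) * expectation (\<lambda>x. iexp (?c s * ?Z x))"
          by simp
        also have "expectation (\<lambda>x. iexp (?c s * ?Z x)) = exp (\<Sum>j=1..h. ln_char_sq (\<alpha> j) (?c s * \<omega> j))"
          using assms by (intro char_weighted_square_sum)
        finally show ?thesis
          by (simp add: exp_diff exp_minus field_simps)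
      qed
    qed simp
    then have "continuous_log (\<lambda>s. expectation (\<lambda>x. exp (\<i> * of_real (s * standardized M ?Z x)))) t
        - continuous_log (\<lambda>s. of_real (exp (- (1 / 2) * s\<^sup>2))) t = ?g t + of_real (t\<^sup>2 / 2)"
      unfolding gauss by simp
    moreover have "norm (?g t + of_real (t\<^sup>2 / 2)) \<le> \<bar>t\<bar> ^ 3
        * norm ((\<omega> 1) ^ 3 / (\<omega> h) ^ 3 * alpha_bar \<alpha> h powr (- (1 / 2)) * real h powr (- (1 / 2)))"
      by (rule remainder(2))
    ultimately show "norm (cmod
        (continuous_log (\<lambda>s. expectation (\<lambda>x. exp (\<i> * of_real (s * standardized M ?Z x)))) t
         - continuous_log (\<lambda>s. of_real (exp (- (1 / 2) * s\<^sup>2))) t))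
      \<le> \<bar>t\<bar> ^ 3 * norm ((\<omega> 1) ^ 3 / (\<omega> h) ^ 3 * alpha_bar \<alpha> h powr (- (1 / 2)) * real h powr (- (1 / 2)))"
      by simp
  qed
qed

end
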